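(* For $n,k\ge 0$ let $a^{213}_{n,k}$ be the number of permutations $\sigma\in S_n$ that avoid the classical pattern $3\textrm{-}1\textrm{-}2$ and contain exactly $k$ occurrences of the consecutive pattern $213$, and let $A^{213}(t,z)=\sum_{n,k\ge 0}a^{213}_{n,k}t^nz^k$. Then $$A^{213}(t,z)=\frac{1-2t+2tz-\sqrt{(1-2t)^2-4t^2z}}{2tz},$$ and for all $n\ge 1$ and $k\ge 0$, $$a^{213}_{n,k}=2^{n-2k-1}C_k\binom{n-1}{2k},$$ where $C_k=\frac{1}{k+1}\binom{2k}{k}$ is the $k$-th Catalan number.
   Context: A permutation $\sigma\in S_n$ avoids the classical pattern $3\textrm{-}1\textrm{-}2$ if there are no indices $i<j<l$ with $\sigma(j)<\sigma(l)<\sigma(i)$; $S_n(3\textrm{-}1\textrm{-}2)$ denotes the set of such permutations. For $\tau\in S_3$, an occurrence of the consecutive pattern $\tau$ in $\sigma\in S_n$ is an index $i$ with $1\le i\le n-2$ such that $\sigma(i)\sigma(i+1)\sigma(i+2)$ is order-isomorphic to $\tau$ (i.e. $\sigma(i+a-1)<\sigma(i+b-1)$ iff $\tau(a)<\tau(b)$). *)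

theory Defs
  imports
    "HOL-Combinatorics.Permutations"
    "HOL-Computational_Algebra.Formal_Laurent_Series"
begin

definition avoids_312 :: "nat \<Rightarrow> (nat \<Rightarrow> nat) \<Rightarrow> bool" where
  "avoids_312 n \<sigma> \<longleftrightarrow>
     \<not> (\<exists>i j l. 1 \<le> i \<and> i < j \<and> j < l \<and> l \<le> n \<and> \<sigma> j < \<sigma> l \<and> \<sigma> l < \<sigma> i)"

definition Av312 :: "nat \<Rightarrow> (nat \<Rightarrow> nat) set" where
  "Av312 n = {\<sigma>. \<sigma> permutes {1..n} \<and> avoids_312 n \<sigma>}"

definition consec_occs :: "(nat \<Rightarrow> nat) \<Rightarrow> nat \<Rightarrow> (nat \<Rightarrow> nat) \<Rightarrow> nat set" where
  "consec_occs \<tau> n \<sigma> =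
     {i. 1 \<le> i \<and> i + 2 \<le> n \<and>
         (\<forall>a\<in>{1..3}. \<forall>b\<in>{1..3}. \<sigma> (i + a - 1) < \<sigma> (i + b - 1) \<longleftrightarrow> \<tau> a < \<tau> b)}"

definition pat213 :: "nat \<Rightarrow> nat" where
  "pat213 = id(1 := 2, 2 := 1, 3 := 3)"

lemma pat213_permutes: "pat213 permutes {1..3}"
proof -
  have "pat213 = Transposition.transpose 1 2"
    by (auto simp: fun_eq_iff pat213_def transpose_def)
  moreover have "Transposition.transpose 1 2 permutes {1..3::nat}"
    by (rule permutes_swap_id) auto
  ultimately show ?thesis by simp
qed

definition a213 :: "nat \<Rightarrow> nat \<Rightarrow> nat" where
  "a213 n k = card {\<sigma> \<in> Av312 n. card (consec_occs pat213 n \<sigma>) = k}"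

text \<open>
  Bivariate series in \<open>t\<close> and \<open>z\<close> have type \<open>rat fps fps\<close>: the outer variable is \<open>t\<close>, the inner
  one \<open>z\<close>, so the coefficient of \<open>t\<^sup>n z\<^sup>k\<close> in \<open>F\<close> is \<open>F $ n $ k\<close>.
\<close>

definition A213 :: "rat fps fps" where
  "A213 = Abs_fps (\<lambda>n. Abs_fps (\<lambda>k. of_nat (a213 n k)))"

text \<open>
  In \<open>rat fps fps\<close> the library's division by \<open>2tz\<close> is not meaningful, as \<open>z\<close> has no inverse
  in \<open>rat fps\<close>. Closed forms with such denominators are therefore stated in the larger ring of power
  series in \<open>t\<close> over the field of formal Laurent series in \<open>z\<close>, of type \<open>rat fls fps\<close>.
\<close>

definition embed_z :: "rat fps fps \<Rightarrow> rat fls fps" where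
  "embed_z F = Abs_fps (\<lambda>n. fps_to_fls (F $ n))"

lemma inj_embed_z: "inj embed_z"
  by (auto simp: inj_def embed_z_def fps_eq_iff[where 'a = "rat fls"] intro!: fps_ext)

definition var_t :: "rat fls fps" where
  "var_t = fps_X"

definition var_z :: "rat fls fps" where
  "var_z = fps_const fls_X"

text \<open>
  Square root of a power series with constant term 1, with the branch whose constant term is 1;
  the first argument of \<open>fps_radical\<close> selects the root of the constant term.
\<close>

definition fps_sqrt :: "'a::field_char_0 fps \<Rightarrow> 'a fps" where
  "fps_sqrt F = fps_radical (\<lambda>_ _. 1) 2 F"

lemma fps_sqrt_unique:
  assumes "F $ 0 = 1"
  shows "S = fps_sqrt F \<longleftrightarrow> S ^ 2 = F \<and> S $ 0 = 1"
  using radical_unique[of "\<lambda>_ _. 1" 1 F S] assms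
  by (auto simp: fps_sqrt_def numeral_2_eq_2)

text \<open>
  The quotient in the closed form of the generating function is exact, so that the library's
  truncating division \<open>/\<close> on power series is the honest quotient there.
\<close>

lemma closed_form_dvd:
  "2 * var_t * var_z dvd
     1 - 2 * var_t + 2 * var_t * var_z - fps_sqrt ((1 - 2 * var_t)^2 - 4 * var_t^2 * var_z)"
  (is "?d dvd ?N")
proof -
  let ?F = "(1 - 2 * var_t)^2 - 4 * var_t^2 * var_z"
  have "?F $ 0 = 1" by (simp add: var_t_def power2_eq_square)
  hence "fps_sqrt ?F $ 0 = 1" using fps_sqrt_unique by blast
  hence "?N $ 0 = 0" by (simp add: var_t_def)
  hence "subdegree ?N \<ge> 1 \<or> ?N = 0"
    by (metis One_nat_def Suc_leI nth_subdegree_nonzero not_gr_zero)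
  hence "fps_X dvd ?N"
    using fps_dvd_iff[of "fps_X :: rat fls fps" ?N]
    by (cases "?N = 0") (simp_all only: dvd_0_right fps_X_neq_zero
        subdegree_fps_X simp_thms not_False_eq_True)
  moreover have "?d dvd fps_X"
  proof -
    have "(fps_X :: rat fls fps) = ?d * fps_const (inverse (2 * fls_X))"
      by (simp add: var_t_def var_z_def numeral_fps_const mult.assoc del: fps_const_mult)
    thus ?thesis by (rule dvdI)
  qed
  ultimately show ?thesis by (rule dvd_trans[rotated])
qed

definition catalan :: "nat \<Rightarrow> rat" where
  "catalan k = 1 / of_nat (k + 1) * of_nat ((2 * k) choose k)"

end

theory Submission
  imports Defs
begin

text \<open>
  If \<open>\<sigma>\<close> avoids 3-1-2 then every entry to the left of the entry 1 is smaller than every entry to its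
  right, so \<open>\<sigma> = (L 1) \<oplus> R\<close> with two arbitrary smaller avoiders \<open>L\<close> and \<open>R\<close>. The consecutive
  occurrences of 213 are those of \<open>L\<close>, those of \<open>R\<close>, and one more centred at 1 if neither part is
  empty. Hence \<open>B = A - 1\<close> satisfies \<open>B = t (1 + 2 B + z B\<^sup>2)\<close>, and completing the square gives the
  closed form. With \<open>u = t / (1 - 2 t)\<close> the equation reads \<open>B = u (1 + z B\<^sup>2)\<close>, which is also
  satisfied by \<open>u C(z u\<^sup>2)\<close> for the generating function \<open>C\<close> of the Catalan numbers; so the
  coefficient of \<open>z\<^sup>k\<close> in \<open>B\<close> is \<open>C\<^sub>k u\<^bsup>2k+1\<^esup>\<close>.
\<close>

section \<open>Direct sums of permutations\<close>

lemma permutes_initial_eq_0_iff: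
  assumes "p permutes {1..n::nat}"
  shows "p i = 0 \<longleftrightarrow> i = 0"
  using permutes_in_image[OF assms, of i] permutes_not_in[OF assms, of i]
  by (cases "i \<in> {1..n}") auto

lemma permutes_le_iff_if_image:
  assumes p: "p permutes {1..n::nat}" and image: "p ` {1..a} = {1..a}"
  shows "p i \<le> a \<longleftrightarrow> i \<le> a"
proof (cases "i = 0")
  case True
  thus ?thesis using permutes_initial_eq_0_iff[OF p, of 0] by simp
next
  case False
  moreover from False have "p i \<noteq> 0" by (simp add: permutes_initial_eq_0_iff[OF p])
  ultimately show ?thesis
    using inj_image_mem_iff[OF permutes_inj[OF p], of i "{1..a}"] image by auto
qed

lemma permutes_initial_le_iff: "p permutes {1..n::nat} \<Longrightarrow> p i \<le> n \<longleftrightarrow> i \<le> n"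
  by (rule permutes_le_iff_if_image[OF _ permutes_image])

definition direct_sum :: "nat \<Rightarrow> (nat \<Rightarrow> nat) \<Rightarrow> (nat \<Rightarrow> nat) \<Rightarrow> nat \<Rightarrow> nat" where
  "direct_sum a \<alpha> \<beta> i = (if i \<le> a then \<alpha> i else a + \<beta> (i - a))"

lemma direct_sum_left: "i \<le> a \<Longrightarrow> direct_sum a \<alpha> \<beta> i = \<alpha> i"
  by (simp add: direct_sum_def)

lemma direct_sum_right: "0 < i \<Longrightarrow> direct_sum a \<alpha> \<beta> (a + i) = a + \<beta> i"
  by (simp add: direct_sum_def)

lemma direct_sum_le_iff:
  assumes "\<alpha> permutes {1..a}" "\<beta> permutes {1..b}"
  shows "direct_sum a \<alpha> \<beta> i \<le> a \<longleftrightarrow> i \<le> a"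
  using assms by (simp add: direct_sum_def permutes_initial_le_iff permutes_initial_eq_0_iff)

lemma direct_sum_permutes:
  assumes \<alpha>: "\<alpha> permutes {1..a}" and \<beta>: "\<beta> permutes {1..b}"
  shows "direct_sum a \<alpha> \<beta> permutes {1..a + b}"
proof (rule inj_imp_permutes)
  show "inj_on (direct_sum a \<alpha> \<beta>) {1..a + b}"
  proof (rule inj_onI)
    fix i j assume eq: "direct_sum a \<alpha> \<beta> i = direct_sum a \<alpha> \<beta> j"
    hence "i \<le> a \<longleftrightarrow> j \<le> a" by (metis direct_sum_le_iff[OF assms])
    thus "i = j"
      using eq inj_eq[OF permutes_inj[OF \<alpha>]] inj_eq[OF permutes_inj[OF \<beta>]]
      by (auto simp: direct_sum_def split: if_splits)
  qed
  show "direct_sum a \<alpha> \<beta> i \<in> {1..a + b}" if "i \<in> {1..a + b}" for i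
    using that permutes_in_image[OF \<alpha>, of i] permutes_in_image[OF \<beta>, of "i - a"]
    by (auto simp: direct_sum_def)
  show "direct_sum a \<alpha> \<beta> i = i" if "i \<notin> {1..a + b}" for i
  proof -
    have "i \<notin> {1..a}" "i - a \<notin> {1..b}" using that by auto
    hence "\<alpha> i = i" "\<beta> (i - a) = i - a"
      by (simp_all only: permutes_not_in[OF \<alpha>] permutes_not_in[OF \<beta>] not_False_eq_True)
    thus ?thesis by (simp add: direct_sum_def)
  qed
qed simp

lemma direct_sum_inject:
  assumes "\<alpha> permutes {1..a}" "\<alpha>' permutes {1..a}" "\<beta> permutes {1..b}" "\<beta>' permutes {1..b'}"
    and eq: "direct_sum a \<alpha> \<beta> = direct_sum a \<alpha>' \<beta>'"
  shows "\<alpha> = \<alpha>'" "\<beta> = \<beta>'"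
proof -
  show "\<alpha> = \<alpha>'"
  proof
    fix i show "\<alpha> i = \<alpha>' i"
      using fun_cong[OF eq, of i] permutes_not_in[OF assms(1), of i]
        permutes_not_in[OF assms(2), of i]
      by (cases "i \<le> a") (simp_all add: direct_sum_left)
  qed
  show "\<beta> = \<beta>'"
  proof
    fix i show "\<beta> i = \<beta>' i"
      using fun_cong[OF eq, of "a + i"] permutes_initial_eq_0_iff[OF assms(3), of i]
        permutes_initial_eq_0_iff[OF assms(4), of i]
      by (cases "i = 0") (simp_all add: direct_sum_right)
  qed
qed

lemma permutes_direct_sumE:
  assumes \<sigma>: "\<sigma> permutes {1..a + b}" and image: "\<sigma> ` {1..a} = {1..a}"
  obtains \<alpha> \<beta> where "\<alpha> permutes {1..a}" "\<beta> permutes {1..b}" "\<sigma> = direct_sum a \<alpha> \<beta>"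
proof
  define \<alpha> where "\<alpha> i = (if i \<le> a then \<sigma> i else i)" for i
  define \<beta> where "\<beta> i = \<sigma> (a + i) - a" for i
  note le_iff = permutes_le_iff_if_image[OF assms]
  show "\<sigma> = direct_sum a \<alpha> \<beta>"
  proof
    fix i show "\<sigma> i = direct_sum a \<alpha> \<beta> i"
      using le_iff[of i] by (auto simp: direct_sum_def \<alpha>_def \<beta>_def)
  qed
  show "\<alpha> permutes {1..a}"
  proof (rule inj_imp_permutes)
    show "inj_on \<alpha> {1..a}"
      using permutes_inj_on[OF \<sigma>] by (auto simp: \<alpha>_def inj_on_def)
    show "\<alpha> i = i" if "i \<notin> {1..a}" for i
      using that permutes_initial_eq_0_iff[OF \<sigma>, of i] by (cases "i = 0") (auto simp: \<alpha>_def)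
  qed (use image in \<open>auto simp: \<alpha>_def\<close>)
  show "\<beta> permutes {1..b}"
  proof (rule inj_imp_permutes)
    show "inj_on \<beta> {1..b}"
    proof (rule inj_onI)
      fix i j assume "i \<in> {1..b}" "j \<in> {1..b}" "\<beta> i = \<beta> j"
      hence "\<sigma> (a + i) = \<sigma> (a + j)"
        using le_iff[of "a + i"] le_iff[of "a + j"] by (simp add: \<beta>_def)
      thus "i = j" by (simp add: inj_eq[OF permutes_inj[OF \<sigma>]])
    qed
    show "\<beta> i \<in> {1..b}" if "i \<in> {1..b}" for i
      using that permutes_in_image[OF \<sigma>, of "a + i"] le_iff[of "a + i"] by (auto simp: \<beta>_def)
    show "\<beta> i = i" if "i \<notin> {1..b}" for i
      using that permutes_not_in[OF \<sigma>, of "a + i"] le_iff[of a] by (cases "i = 0") (auto simp: \<beta>_def)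
  qed simp
qed

lemma permutes_image_initial_segment:
  fixes a n :: nat
  assumes \<sigma>: "\<sigma> permutes {1..n}"
    and less: "\<And>i l. 1 \<le> i \<Longrightarrow> i \<le> a \<Longrightarrow> a < l \<Longrightarrow> l \<le> n \<Longrightarrow> \<sigma> i < \<sigma> l"
    and "a \<le> n"
  shows "\<sigma> ` {1..a} = {1..a}"
proof (rule endo_inj_surj)
  show "\<sigma> ` {1..a} \<subseteq> {1..a}"
  proof clarify
    fix i assume i: "i \<in> {1..a}"
    hence \<sigma>_i: "\<sigma> i \<in> {1..n}" using \<open>a \<le> n\<close> by (simp only: permutes_in_image[OF \<sigma>]) simp
    have "{1..\<sigma> i} \<subseteq> \<sigma> ` {1..a}"
    proof
      fix v assume v: "v \<in> {1..\<sigma> i}"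
      hence "v \<in> \<sigma> ` {1..n}" using \<sigma>_i permutes_image[OF \<sigma>] by auto
      then obtain l where l: "v = \<sigma> l" "1 \<le> l" "l \<le> n" by auto
      have "l \<le> a" using less[of i l] i l v by force
      thus "v \<in> \<sigma> ` {1..a}" using l by auto
    qed
    hence "card {1..\<sigma> i} \<le> card (\<sigma> ` {1..a})" by (intro card_mono) auto
    thus "\<sigma> i \<in> {1..a}" using \<sigma>_i by (simp add: card_image permutes_inj_on[OF \<sigma>])
  qed
qed (simp_all add: permutes_inj_on[OF \<sigma>])

section \<open>Appending a new minimum\<close>

definition append_min :: "nat \<Rightarrow> (nat \<Rightarrow> nat) \<Rightarrow> nat \<Rightarrow> nat" where
  "append_min m L i = (if i \<in> {1..m} then Suc (L i) else if i = Suc m then 1 else i)"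

lemma append_min_last [simp]: "append_min m L (Suc m) = 1"
  by (simp add: append_min_def)

lemma append_min_init: "1 \<le> i \<Longrightarrow> i \<le> m \<Longrightarrow> append_min m L i = Suc (L i)"
  by (simp add: append_min_def)

lemma append_min_permutes:
  assumes L: "L permutes {1..m}"
  shows "append_min m L permutes {1..Suc m}"
proof (rule inj_imp_permutes)
  show "inj_on (append_min m L) {1..Suc m}"
    using inj_eq[OF permutes_inj[OF L]] permutes_initial_eq_0_iff[OF L]
    by (auto simp: append_min_def inj_on_def)
  show "append_min m L i \<in> {1..Suc m}" if "i \<in> {1..Suc m}" for i
    using that permutes_initial_le_iff[OF L, of i] by (auto simp: append_min_def)
qed (auto simp: append_min_def)

lemma append_min_inject:
  assumes "L permutes {1..m}" "L' permutes {1..m}" and eq: "append_min m L = append_min m L'"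
  shows "L = L'"
proof
  fix i show "L i = L' i"
    using fun_cong[OF eq, of i] permutes_not_in[OF assms(1), of i] permutes_not_in[OF assms(2), of i]
    by (cases "i \<in> {1..m}") (simp_all add: append_min_def)
qed

lemma permutes_append_minE:
  assumes \<sigma>: "\<sigma> permutes {1..Suc m}" and one: "\<sigma> (Suc m) = 1"
  obtains L where "L permutes {1..m}" "\<sigma> = append_min m L"
proof
  define L where "L i = (if i \<in> {1..m} then \<sigma> i - 1 else i)" for i
  have bounds: "2 \<le> \<sigma> i \<and> \<sigma> i \<le> Suc m" if "i \<in> {1..m}" for i
  proof -
    have "\<sigma> i \<noteq> \<sigma> (Suc m)" using that inj_eq[OF permutes_inj[OF \<sigma>]] by auto
    thus ?thesis using that one permutes_in_image[OF \<sigma>, of i] by auto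
  qed
  show "L permutes {1..m}"
  proof (rule inj_imp_permutes)
    show "inj_on L {1..m}"
    proof (rule inj_onI)
      fix i j assume "i \<in> {1..m}" "j \<in> {1..m}" "L i = L j"
      hence "\<sigma> i = \<sigma> j" using bounds[of i] bounds[of j] by (auto simp: L_def)
      thus "i = j" by (simp add: inj_eq[OF permutes_inj[OF \<sigma>]])
    qed
  qed (use bounds in \<open>force simp: L_def\<close>)+
  show "\<sigma> = append_min m L"
  proof
    fix i show "\<sigma> i = append_min m L i"
      using one bounds[of i] permutes_not_in[OF \<sigma>, of i] by (auto simp: append_min_def L_def)
  qed
qed

section \<open>Avoiding 3-1-2\<close>

lemma avoids_312D:
  assumes "avoids_312 n \<sigma>" "1 \<le> i" "i < j" "j < l" "l \<le> n" "\<sigma> j < \<sigma> l"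
  shows "\<sigma> i \<le> \<sigma> l"
  using assms unfolding avoids_312_def by (meson not_le)

lemma avoids_312_subpattern:
  assumes av: "avoids_312 n \<sigma>"
    and mono: "strict_mono_on {1..k} f" and range: "f ` {1..k} \<subseteq> {1..n}"
    and order: "\<And>i j. i \<in> {1..k} \<Longrightarrow> j \<in> {1..k} \<Longrightarrow> \<tau> i < \<tau> j \<Longrightarrow> \<sigma> (f i) < \<sigma> (f j)"
  shows "avoids_312 k \<tau>"
  unfolding avoids_312_def
proof clarify
  fix i j l assume "1 \<le> i" "i < j" "j < l" "l \<le> k" and pat: "\<tau> j < \<tau> l" "\<tau> l < \<tau> i"
  hence ijl: "i \<in> {1..k}" "j \<in> {1..k}" "l \<in> {1..k}" "i < j" "j < l" by auto
  hence "f i < f j" "f j < f l" using strict_mono_onD[OF mono] by blast+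
  moreover have "f i \<in> {1..n}" "f l \<in> {1..n}" using range ijl by blast+
  ultimately have "\<sigma> (f i) \<le> \<sigma> (f l)"
    using avoids_312D[OF av, of "f i" "f j" "f l"] order[OF ijl(2,3) pat(1)] by simp
  thus False using order[OF ijl(3,1) pat(2)] by simp
qed

lemma avoids_312_direct_sum_iff:
  assumes "\<alpha> permutes {1..a}" "\<beta> permutes {1..b}"
  shows "avoids_312 (a + b) (direct_sum a \<alpha> \<beta>) \<longleftrightarrow> avoids_312 a \<alpha> \<and> avoids_312 b \<beta>"
    (is "avoids_312 _ ?\<sigma> \<longleftrightarrow> _")
proof (intro iffI conjI)
  assume av: "avoids_312 (a + b) ?\<sigma>"
  show "avoids_312 a \<alpha>"
    by (rule avoids_312_subpattern[OF av, of _ id])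
      (auto simp: strict_mono_on_def direct_sum_left)
  show "avoids_312 b \<beta>"
    by (rule avoids_312_subpattern[OF av, of _ "(+) a"])
      (auto simp: strict_mono_on_def direct_sum_right)
next
  assume av: "avoids_312 a \<alpha> \<and> avoids_312 b \<beta>"
  show "avoids_312 (a + b) ?\<sigma>"
    unfolding avoids_312_def
  proof clarify
    fix i j l
    assume ijl: "1 \<le> i" "i < j" "j < l" "l \<le> a + b" and pat: "?\<sigma> j < ?\<sigma> l" "?\<sigma> l < ?\<sigma> i"
    show False
    proof (cases "l \<le> a")
      case True
      thus False using av ijl pat avoids_312D[of a \<alpha> i j l] by (simp add: direct_sum_left)
    next
      case False
      hence "\<not> i \<le> a" using pat direct_sum_le_iff[OF assms, of l] direct_sum_le_iff[OF assms, of i]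
        by linarith
      thus False using av ijl pat avoids_312D[of b \<beta> "i - a" "j - a" "l - a"]
        by (simp add: direct_sum_def diff_less_mono Suc_le_eq le_diff_conv)
    qed
  qed
qed

lemma avoids_312_append_min_iff: "avoids_312 (Suc m) (append_min m L) \<longleftrightarrow> avoids_312 m L"
proof
  assume av: "avoids_312 (Suc m) (append_min m L)"
  show "avoids_312 m L"
    by (rule avoids_312_subpattern[OF av, of _ id])
      (auto simp: strict_mono_on_def append_min_init)
next
  assume av: "avoids_312 m L"
  show "avoids_312 (Suc m) (append_min m L)"
    unfolding avoids_312_def
  proof clarify
    fix i j l
    assume "1 \<le> i" "i < j" "j < l" "l \<le> Suc m"
      "append_min m L j < append_min m L l" "append_min m L l < append_min m L i"
    thus False using avoids_312D[OF av, of i j l]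
      by (cases "l = Suc m") (auto simp: append_min_init)
  qed
qed

lemma finite_Av312: "finite (Av312 n)"
  by (rule finite_subset[OF _ finite_permutations[of "{1..n}"]]) (auto simp: Av312_def)

lemma Av312_0: "Av312 0 = {id}"
  by (auto simp: Av312_def avoids_312_def)

lemma Av312_image_upto_1:
  assumes \<sigma>: "\<sigma> \<in> Av312 n" and "a \<le> n" and one: "\<sigma> a = 1"
  shows "\<sigma> ` {1..a} = {1..a}"
proof (rule permutes_image_initial_segment)
  show perm: "\<sigma> permutes {1..n}" using \<sigma> by (simp add: Av312_def)
  fix i l assume il: "1 \<le> i" "i \<le> a" "a < l" "l \<le> n"
  have "\<sigma> l \<noteq> \<sigma> a" "\<sigma> l \<noteq> \<sigma> i" using il inj_eq[OF permutes_inj[OF perm]] by auto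
  moreover have "\<sigma> l \<noteq> 0" using il permutes_initial_eq_0_iff[OF perm] by simp
  ultimately have "\<sigma> a < \<sigma> l" using one by simp
  moreover from this have "\<sigma> i \<le> \<sigma> l" if "i < a"
    using \<sigma> il that avoids_312D[of n \<sigma> i a l] by (simp add: Av312_def)
  ultimately show "\<sigma> i < \<sigma> l" using il \<open>\<sigma> l \<noteq> \<sigma> i\<close> by (cases "i = a") auto
qed (fact \<open>a \<le> n\<close>)

definition join_at_1 :: "nat \<Rightarrow> (nat \<Rightarrow> nat) \<Rightarrow> (nat \<Rightarrow> nat) \<Rightarrow> nat \<Rightarrow> nat" where
  "join_at_1 m L R = direct_sum (Suc m) (append_min m L) R"

lemma join_at_1_in_Av312_iff:
  assumes "L permutes {1..m}" "R permutes {1..r}"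
  shows "join_at_1 m L R \<in> Av312 (Suc m + r) \<longleftrightarrow> L \<in> Av312 m \<and> R \<in> Av312 r"
  unfolding Av312_def mem_Collect_eq join_at_1_def
  using assms append_min_permutes[OF assms(1)]
  by (simp only: direct_sum_permutes avoids_312_direct_sum_iff avoids_312_append_min_iff simp_thms)

lemma join_at_1_inject:
  assumes "L permutes {1..m}" "L' permutes {1..m}" "R permutes {1..r}" "R' permutes {1..r}"
    and eq: "join_at_1 m L R = join_at_1 m L' R'"
  shows "L = L'" "R = R'"
proof -
  note sum_eq = eq[unfolded join_at_1_def]
  have "append_min m L = append_min m L'"
    by (rule direct_sum_inject(1)[OF _ _ _ _ sum_eq]) (rule append_min_permutes assms)+
  thus "L = L'" by (rule append_min_inject[OF assms(1,2)])
  show "R = R'"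
    by (rule direct_sum_inject(2)[OF _ _ _ _ sum_eq]) (rule append_min_permutes assms)+
qed

lemma Av312_join_at_1E:
  assumes \<sigma>: "\<sigma> \<in> Av312 (Suc m + r)" and one: "\<sigma> (Suc m) = 1"
  obtains L R where "L \<in> Av312 m" "R \<in> Av312 r" "\<sigma> = join_at_1 m L R"
proof -
  have perm: "\<sigma> permutes {1..Suc m + r}" using \<sigma> by (simp add: Av312_def)
  have "\<sigma> ` {1..Suc m} = {1..Suc m}" by (rule Av312_image_upto_1[OF \<sigma> _ one]) simp
  then obtain \<alpha> R where \<alpha>: "\<alpha> permutes {1..Suc m}" and R: "R permutes {1..r}"
    and sum: "\<sigma> = direct_sum (Suc m) \<alpha> R"
    using permutes_direct_sumE[OF perm] by blast
  have "\<alpha> (Suc m) = 1" using one by (simp add: sum direct_sum_left)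
  then obtain L where L: "L permutes {1..m}" "\<alpha> = append_min m L"
    using permutes_append_minE[OF \<alpha>] by blast
  have join: "\<sigma> = join_at_1 m L R" by (simp add: join_at_1_def sum L)
  hence "L \<in> Av312 m \<and> R \<in> Av312 r" using \<sigma> L R join_at_1_in_Av312_iff by blast
  thus thesis using that join by blast
qed

lemma bij_betw_join_at_1:
  "bij_betw (\<lambda>(L, R). join_at_1 m L R) (Av312 m \<times> Av312 r)
     {\<sigma> \<in> Av312 (Suc m + r). \<sigma> (Suc m) = 1}"
proof (rule bij_betw_imageI)
  show "inj_on (\<lambda>(L, R). join_at_1 m L R) (Av312 m \<times> Av312 r)"
    unfolding inj_on_def Av312_def using join_at_1_inject by fast
  have "join_at_1 m L R \<in> Av312 (Suc m + r)" if "L \<in> Av312 m" "R \<in> Av312 r" for L R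
    using that join_at_1_in_Av312_iff by (simp add: Av312_def)
  moreover have "join_at_1 m L R (Suc m) = 1" for L R
    by (simp add: join_at_1_def direct_sum_left)
  ultimately show "(\<lambda>(L, R). join_at_1 m L R) ` (Av312 m \<times> Av312 r) =
      {\<sigma> \<in> Av312 (Suc m + r). \<sigma> (Suc m) = 1}"
    by (auto elim!: Av312_join_at_1E simp del: add_Suc)
qed

section \<open>Consecutive occurrences of 213\<close>

lemma finite_consec_occs: "finite (consec_occs \<tau> n \<sigma>)"
  by (rule finite_subset[of _ "{..n}"]) (auto simp: consec_occs_def)

lemma consec_occs_pat213:
  "consec_occs pat213 n \<sigma> = {i. 1 \<le> i \<and> i + 2 \<le> n \<and> \<sigma> (i + 1) < \<sigma> i \<and> \<sigma> i < \<sigma> (i + 2)}"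
proof -
  have "{1..3} = {1, 2, 3 :: nat}" by auto
  thus ?thesis by (auto simp: consec_occs_def pat213_def)
qed

lemma consec_occs_pat213_direct_sum:
  assumes "\<alpha> permutes {1..a}" "\<beta> permutes {1..b}"
  shows "consec_occs pat213 (a + b) (direct_sum a \<alpha> \<beta>) =
    consec_occs pat213 a \<alpha> \<union> {i. 1 \<le> i \<and> Suc i = a \<and> 0 < b \<and> \<alpha> a < \<alpha> i}
      \<union> (+) a ` consec_occs pat213 b \<beta>" (is "?S = ?L \<union> ?M \<union> ?R")
proof (rule set_eqI)
  let ?\<sigma> = "direct_sum a \<alpha> \<beta>"
  fix i
  consider (left) "i + 2 \<le> a" | (penultimate) "Suc i = a" | (last) "i = a"
    | (right) k where "0 < k" "i = a + k"
    using that(4)[of "i - a"] by linarith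
  thus "i \<in> ?S \<longleftrightarrow> i \<in> ?L \<union> ?M \<union> ?R"
  proof cases
    case left
    thus ?thesis by (auto simp: consec_occs_pat213 direct_sum_left)
  next
    case penultimate
    hence "?\<sigma> i < ?\<sigma> (i + 2)"
      using direct_sum_le_iff[OF assms, of i] direct_sum_le_iff[OF assms, of "i + 2"] by linarith
    thus ?thesis using penultimate by (auto simp: consec_occs_pat213 direct_sum_left)
  next
    case last
    hence "?\<sigma> i < ?\<sigma> (i + 1)"
      using direct_sum_le_iff[OF assms, of i] direct_sum_le_iff[OF assms, of "i + 1"] by linarith
    thus ?thesis using last by (auto simp: consec_occs_pat213)
  next
    case right
    thus ?thesis
      using direct_sum_right[of "k + 1" a \<alpha> \<beta>] direct_sum_right[of "k + 2" a \<alpha> \<beta>]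
      by (auto simp: consec_occs_pat213 direct_sum_right add.assoc)
  qed
qed

lemma consec_occs_pat213_append_min:
  "consec_occs pat213 (Suc m) (append_min m L) = consec_occs pat213 m L"
proof (rule set_eqI)
  fix i show "i \<in> consec_occs pat213 (Suc m) (append_min m L) \<longleftrightarrow> i \<in> consec_occs pat213 m L"
    by (cases "i + 1 = m") (auto simp: consec_occs_pat213 append_min_def)
qed

lemma card_consec_occs_join_at_1:
  assumes L: "L permutes {1..m}" and R: "R permutes {1..r}"
  shows "card (consec_occs pat213 (Suc m + r) (join_at_1 m L R)) =
    card (consec_occs pat213 m L) + card (consec_occs pat213 r R)
      + (if m = 0 \<or> r = 0 then 0 else 1)"
proof -
  let ?occs = "consec_occs pat213"
  let ?M = "if m = 0 \<or> r = 0 then {} else {m}" and ?R = "(+) (Suc m) ` ?occs r R"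
  have "{i. 1 \<le> i \<and> Suc i = Suc m \<and> 0 < r \<and> append_min m L (Suc m) < append_min m L i} = ?M"
    using permutes_initial_eq_0_iff[OF L, of m] by (auto simp: append_min_init)
  hence "?occs (Suc m + r) (join_at_1 m L R) = ?occs m L \<union> ?M \<union> ?R"
    by (simp only: join_at_1_def consec_occs_pat213_direct_sum[OF append_min_permutes[OF L] R]
        consec_occs_pat213_append_min)
  moreover have "card (?occs m L \<union> ?M \<union> ?R) = card (?occs m L) + card ?M + card ?R"
  proof -
    have "?occs m L \<inter> ?M = {}" "(?occs m L \<union> ?M) \<inter> ?R = {}"
      by (auto simp: consec_occs_pat213)
    thus ?thesis by (simp add: card_Un_disjoint finite_consec_occs)
  qed
  moreover have "card ?R = card (?occs r R)" by (simp add: card_image inj_on_def)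
  ultimately show ?thesis by simp
qed

section \<open>The functional equation\<close>

definition occ_weight :: "nat \<Rightarrow> (nat \<Rightarrow> nat) \<Rightarrow> rat fps" where
  "occ_weight n \<sigma> = fps_X ^ card (consec_occs pat213 n \<sigma>)"

lemma A213_nth: "A213 $ n = (\<Sum>\<sigma>\<in>Av312 n. occ_weight n \<sigma>)"
proof (rule fps_ext)
  fix k
  have "(\<Sum>\<sigma>\<in>Av312 n. occ_weight n \<sigma>) $ k =
      (\<Sum>\<sigma>\<in>Av312 n. if card (consec_occs pat213 n \<sigma>) = k then 1 else 0)"
    by (auto simp: occ_weight_def fps_sum_nth intro!: sum.cong)
  also have "\<dots> = of_nat (a213 n k)"
    by (simp add: a213_def sum.If_cases finite_Av312 Int_def)
  finally show "A213 $ n $ k = (\<Sum>\<sigma>\<in>Av312 n. occ_weight n \<sigma>) $ k"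
    by (simp add: A213_def)
qed

lemma A213_nth_0: "A213 $ 0 = 1"
  by (simp add: A213_nth Av312_0 occ_weight_def consec_occs_def)

lemma sum_occ_weight_1_at:
  "(\<Sum>\<sigma> | \<sigma> \<in> Av312 (Suc m + r) \<and> \<sigma> (Suc m) = 1. occ_weight (Suc m + r) \<sigma>) =
     (if m = 0 \<or> r = 0 then 1 else fps_X) * (A213 $ m * A213 $ r)"
proof -
  let ?c = "if m = 0 \<or> r = 0 then 1 else fps_X :: rat fps"
  have "(\<Sum>\<sigma> | \<sigma> \<in> Av312 (Suc m + r) \<and> \<sigma> (Suc m) = 1. occ_weight (Suc m + r) \<sigma>) =
      (\<Sum>(L, R)\<in>Av312 m \<times> Av312 r. occ_weight (Suc m + r) (join_at_1 m L R))"
    by (subst sum.reindex_bij_betw[OF bij_betw_join_at_1, symmetric]) (simp add: case_prod_unfold)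
  also have "\<dots> = (\<Sum>(L, R)\<in>Av312 m \<times> Av312 r. ?c * (occ_weight m L * occ_weight r R))"
  proof (rule sum.cong[OF refl], clarify)
    fix L R assume "L \<in> Av312 m" "R \<in> Av312 r"
    hence "L permutes {1..m}" "R permutes {1..r}" by (auto simp: Av312_def)
    thus "occ_weight (Suc m + r) (join_at_1 m L R) = ?c * (occ_weight m L * occ_weight r R)"
      unfolding occ_weight_def
      by (simp only: card_consec_occs_join_at_1) (simp add: power_add)
  qed
  also have "\<dots> = ?c * (A213 $ m * A213 $ r)"
    unfolding A213_nth sum_product sum.cartesian_product
    by (simp only: sum_distrib_left case_prod_unfold)
  finally show ?thesis .
qed

lemma A213_nth_Suc:
  "A213 $ Suc n =
     (\<Sum>m\<le>n. (if m = 0 \<or> n - m = 0 then 1 else fps_X) * (A213 $ m * A213 $ (n - m)))"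
proof -
  let ?S = "\<lambda>m. {\<sigma> \<in> Av312 (Suc n). \<sigma> (Suc m) = 1}"
  have "Av312 (Suc n) = (\<Union>m\<in>{..n}. ?S m)"
  proof (intro equalityI subsetI)
    fix \<sigma> assume \<sigma>: "\<sigma> \<in> Av312 (Suc n)"
    hence "1 \<in> \<sigma> ` {1..Suc n}" by (simp add: Av312_def permutes_image)
    then obtain i where "1 \<le> i" "i \<le> Suc n" "\<sigma> i = 1" by auto
    thus "\<sigma> \<in> (\<Union>m\<in>{..n}. ?S m)" using \<sigma> by (auto intro!: bexI[of _ "i - 1"])
  qed auto
  hence "A213 $ Suc n = (\<Sum>\<sigma>\<in>(\<Union>m\<in>{..n}. ?S m). occ_weight (Suc n) \<sigma>)"
    by (simp add: A213_nth)
  also have "\<dots> = (\<Sum>m\<le>n. \<Sum>\<sigma>\<in>?S m. occ_weight (Suc n) \<sigma>)"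
  proof (rule sum.UNION_disjoint)
    show "\<forall>i\<in>{..n}. \<forall>j\<in>{..n}. i \<noteq> j \<longrightarrow> ?S i \<inter> ?S j = {}"
    proof (intro ballI impI equals0I)
      fix i j \<sigma> assume "i \<noteq> j" and \<sigma>: "\<sigma> \<in> ?S i \<inter> ?S j"
      hence "inj \<sigma>" "\<sigma> (Suc i) = \<sigma> (Suc j)" by (auto simp: Av312_def permutes_inj)
      thus False using \<open>i \<noteq> j\<close> by (simp add: inj_eq)
    qed
  qed (auto simp: finite_Av312)
  also have "\<dots> = (\<Sum>m\<le>n. (if m = 0 \<or> n - m = 0 then 1 else fps_X) * (A213 $ m * A213 $ (n - m)))"
    by (rule sum.cong[OF refl], subst sum_occ_weight_1_at[symmetric]) simp
  finally show ?thesis .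
qed

lemma A213_functional_equation:
  defines "B \<equiv> A213 - 1"
  shows "B = fps_X * (1 + 2 * B + fps_const fps_X * B\<^sup>2)"
proof (rule fps_ext)
  fix n
  let ?I = "1 :: rat fps fps" and ?z = "fps_X :: rat fps"
  have weight: "(if m = 0 \<or> r = 0 then 1 else ?z) * (A213 $ m * A213 $ r) =
      ?I $ m * ?I $ r + ?I $ m * B $ r + B $ m * ?I $ r + ?z * (B $ m * B $ r)" for m r
    by (simp add: B_def A213_nth_0 fps_one_nth)
  show "B $ n = (fps_X * (1 + 2 * B + fps_const fps_X * B\<^sup>2)) $ n"
  proof (cases n)
    case (Suc n')
    have "B $ n = (\<Sum>m\<le>n'. ?I $ m * ?I $ (n' - m)) + (\<Sum>m\<le>n'. ?I $ m * B $ (n' - m))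
        + (\<Sum>m\<le>n'. B $ m * ?I $ (n' - m)) + ?z * (\<Sum>m\<le>n'. B $ m * B $ (n' - m))"
      by (simp only: sum_distrib_left flip: sum.distrib weight) (simp add: Suc B_def A213_nth_Suc)
    also have "\<dots> = (?I * ?I + ?I * B + B * ?I + fps_const ?z * (B * B)) $ n'"
      by (simp only: fps_add_nth fps_mult_left_const_nth) (simp only: fps_mult_nth atLeast0AtMost)
    finally show ?thesis by (simp add: Suc power2_eq_square)
  qed (simp add: B_def A213_nth_0)
qed

section \<open>The closed form\<close>

lemma embed_z_add: "embed_z (F + G) = embed_z F + embed_z G"
  by (rule fps_ext) (simp add: embed_z_def)

lemma embed_z_1: "embed_z 1 = 1"
  by (rule fps_ext) (simp add: embed_z_def)

lemma fps_to_fls_sum: "fps_to_fls (sum f A) = (\<Sum>x\<in>A. fps_to_fls (f x))"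
  by (induction A rule: infinite_finite_induct) simp_all

lemma embed_z_mult: "embed_z (F * G) = embed_z F * embed_z G"
  by (rule fps_ext) (simp add: embed_z_def fps_mult_nth fps_to_fls_sum fls_times_fps_to_fls)

lemma embed_z_fps_X: "embed_z fps_X = var_t"
  by (rule fps_ext) (simp add: embed_z_def var_t_def fps_X_nth)

lemma embed_z_const_fps_X: "embed_z (fps_const fps_X) = var_z"
  by (rule fps_ext) (simp add: embed_z_def var_z_def)

lemma quadratic_complete_square:
  fixes t z B :: "'a :: comm_ring_1"
  assumes "B = t * (1 + 2 * B + z * B\<^sup>2)"
  shows "(1 - 2 * t - 2 * t * z * B)\<^sup>2 = (1 - 2 * t)\<^sup>2 - 4 * t\<^sup>2 * z"
proof -
  have "(1 - 2 * t - 2 * t * z * B)\<^sup>2 - ((1 - 2 * t)\<^sup>2 - 4 * t\<^sup>2 * z) =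
      4 * t * z * (t * (1 + 2 * B + z * B\<^sup>2) - B)"
    by (simp add: power2_eq_square algebra_simps)
  thus ?thesis using assms by simp
qed

lemma embed_z_A213_closed_form:
  "embed_z A213 =
     (1 - 2 * var_t + 2 * var_t * var_z
        - fps_sqrt ((1 - 2 * var_t)^2 - 4 * var_t^2 * var_z)) / (2 * var_t * var_z)"
proof -
  define B where "B = embed_z (A213 - 1)"
  have "A213 = 1 + (A213 - 1)" by simp
  hence A213: "embed_z A213 = 1 + B" unfolding B_def by (metis embed_z_add embed_z_1)
  have "B = var_t * (1 + 2 * B + var_z * B\<^sup>2)"
    unfolding B_def
    by (subst A213_functional_equation)
      (simp only: mult_2 power2_eq_square embed_z_add embed_z_mult embed_z_1 embed_z_fps_X
        embed_z_const_fps_X)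
  hence "(1 - 2 * var_t - 2 * var_t * var_z * B)\<^sup>2 = (1 - 2 * var_t)\<^sup>2 - 4 * var_t\<^sup>2 * var_z"
    by (rule quadratic_complete_square)
  hence "fps_sqrt ((1 - 2 * var_t)\<^sup>2 - 4 * var_t\<^sup>2 * var_z) = 1 - 2 * var_t - 2 * var_t * var_z * B"
    by (intro fps_sqrt_unique[THEN iffD2, symmetric]) (simp_all add: var_t_def power2_eq_square)
  hence "1 - 2 * var_t + 2 * var_t * var_z - fps_sqrt ((1 - 2 * var_t)\<^sup>2 - 4 * var_t\<^sup>2 * var_z) =
      (2 * var_t * var_z) * (1 + B)"
    by (simp add: algebra_simps)
  moreover have "2 * var_t * var_z \<noteq> 0" by (simp add: var_t_def var_z_def)
  ultimately show ?thesis by (simp only: A213 nonzero_mult_div_cancel_left not_False_eq_True)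
qed

section \<open>The generating function of the Catalan numbers\<close>

lemma Suc_times_central_binomial_Suc:
  "Suc k * ((2 * Suc k) choose Suc k) = 2 * (2 * k + 1) * ((2 * k) choose k)"
proof -
  have "Suc k * (Suc (2 * k + 1) choose Suc k) = Suc (2 * k + 1) * ((2 * k + 1) choose k)"
    by (rule Suc_times_binomial)
  moreover have "Suc k * (Suc (2 * k) choose Suc k) = Suc (2 * k) * ((2 * k) choose k)"
    by (rule Suc_times_binomial)
  moreover have "Suc (2 * k) choose Suc k = Suc (2 * k) choose k"
    by (subst binomial_symmetric) auto
  ultimately have "Suc k * (Suc k * ((2 * Suc k) choose Suc k)) =
      Suc k * (2 * (2 * k + 1) * ((2 * k) choose k))"
    by (simp add: algebra_simps)
  thus ?thesis by (simp only: mult_cancel1 Suc_not_Zero simp_thms)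
qed

lemma catalan_0: "catalan 0 = 1"
  by (simp add: catalan_def)

lemma Suc_times_catalan: "of_nat (Suc k) * catalan k = of_nat ((2 * k) choose k)"
  by (simp add: catalan_def del: of_nat_Suc)

lemma catalan_Suc: "of_nat (k + 2) * catalan (Suc k) = of_nat (2 * (2 * k + 1)) * catalan k"
proof -
  have "of_nat (Suc k) * (of_nat (k + 2) * catalan (Suc k)) =
      of_nat (Suc k * ((2 * Suc k) choose Suc k))"
    using Suc_times_catalan[of "Suc k"] by (simp only: of_nat_mult add_2_eq_Suc')
  also have "\<dots> = of_nat (2 * (2 * k + 1)) * of_nat ((2 * k) choose k)"
    by (simp only: Suc_times_central_binomial_Suc of_nat_mult)
  also have "\<dots> = of_nat (Suc k) * (of_nat (2 * (2 * k + 1)) * catalan k)"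
    by (simp only: Suc_times_catalan[symmetric] mult.left_commute)
  finally show ?thesis by (simp only: mult_cancel_left of_nat_neq_0 simp_thms)
qed

lemma gbinomial_half_eq_catalan: "(-4) ^ Suc k * (1 / 2 gchoose Suc k) = - 2 * catalan k"
proof (induction k)
  case (Suc k)
  have recurrence: "of_nat (k + 2) * (1 / 2 gchoose Suc (Suc k)) =
      (1 / 2 - of_nat (Suc k) :: rat) * (1 / 2 gchoose Suc k)"
    using gbinomial_mult_1[of "1 / 2 :: rat" "Suc k"] by (simp add: algebra_simps)
  have "of_nat (k + 2) * ((-4) ^ Suc (Suc k) * (1 / 2 gchoose Suc (Suc k))) =
      (-4) ^ Suc (Suc k) * (of_nat (k + 2) * (1 / 2 gchoose Suc (Suc k)) :: rat)"
    by (simp only: mult.left_commute)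
  also have "\<dots> = (-4) ^ Suc (Suc k) * ((1 / 2 - of_nat (Suc k)) * (1 / 2 gchoose Suc k))"
    by (simp only: recurrence)
  also have "\<dots> = of_nat (2 * (2 * k + 1)) * ((-4) ^ Suc k * (1 / 2 gchoose Suc k))"
    by (simp add: algebra_simps)
  also have "\<dots> = - 2 * (of_nat (2 * (2 * k + 1)) * catalan k)"
    by (simp only: Suc.IH mult.left_commute)
  also have "\<dots> = of_nat (k + 2) * (- 2 * catalan (Suc k))"
    by (simp only: catalan_Suc[symmetric] mult.left_commute)
  finally show ?case by (simp only: mult_cancel_left of_nat_neq_0 add_2_eq_Suc' simp_thms)
qed (simp add: catalan_def)

text \<open>By the binomial series, \<open>1 - 2 x C(x)\<close> is the square root of \<open>1 - 4 x\<close>.\<close>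
lemma catalan_fps_eq: "Abs_fps catalan = 1 + fps_X * (Abs_fps catalan)\<^sup>2"
proof -
  let ?C = "Abs_fps catalan" and ?x = "fps_const (-4) * fps_X :: rat fps"
  have sqrt: "fps_binomial (1 / 2) oo ?x = 1 - 2 * fps_X * ?C"
  proof (rule fps_ext)
    fix n show "(fps_binomial (1 / 2) oo ?x) $ n = (1 - 2 * fps_X * ?C) $ n"
      using gbinomial_half_eq_catalan[of "n - 1"]
      by (cases n) (simp_all add: mult.assoc numeral_fps_const)
  qed
  have "(1 - 2 * fps_X * ?C)\<^sup>2 = (fps_binomial (1 / 2) * fps_binomial (1 / 2)) oo ?x"
    by (simp only: sqrt[symmetric] power2_eq_square) (simp add: fps_compose_mult_distrib)
  also have "\<dots> = 1 + ?x"
    by (simp flip: fps_binomial_add_mult add: fps_binomial_1 fps_compose_add_distrib)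
  finally have "4 * fps_X * (1 + fps_X * ?C\<^sup>2) = 4 * fps_X * ?C"
    by (simp add: power2_eq_square algebra_simps numeral_fps_const)
  thus ?thesis by simp
qed

lemma catalan_convolution: "catalan (Suc k) = (\<Sum>i\<le>k. catalan i * catalan (k - i))"
proof -
  have "catalan (Suc k) = (1 + fps_X * (Abs_fps catalan)\<^sup>2) $ Suc k"
    by (subst catalan_fps_eq[symmetric]) simp
  thus ?thesis by (simp add: power2_eq_square fps_mult_nth[of "Abs_fps catalan"] atLeast0AtMost)
qed

section \<open>Solving the functional equation\<close>

definition fps_swap :: "'a fps fps \<Rightarrow> 'a fps fps" where
  "fps_swap F = Abs_fps (\<lambda>k. Abs_fps (\<lambda>n. F $ n $ k))"

lemma fps_swap_nth [simp]: "fps_swap F $ k $ n = F $ n $ k"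
  by (simp add: fps_swap_def)

lemma fps_swap_add: "fps_swap (F + G) = fps_swap F + fps_swap G"
  by (intro fps_ext) simp

lemma fps_swap_mult: "fps_swap (F * G) = fps_swap F * fps_swap G"
proof (intro fps_ext)
  fix k n show "fps_swap (F * G) $ k $ n = (fps_swap F * fps_swap G) $ k $ n"
    by (simp add: fps_mult_nth fps_sum_nth) (rule sum.swap)
qed

lemma fps_swap_1: "fps_swap 1 = 1"
  by (intro fps_ext) simp

lemma fps_swap_fps_X: "fps_swap fps_X = fps_const fps_X"
  by (intro fps_ext) (simp add: fps_X_nth)

lemma fps_swap_const_fps_X: "fps_swap (fps_const fps_X) = fps_X"
  by (intro fps_ext) (simp add: fps_X_nth)

lemma quadratic_root_unique:
  fixes t z B B' :: "'a :: idom"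
  assumes B: "B = t * (1 + 2 * B + z * B\<^sup>2)" and B': "B' = t * (1 + 2 * B' + z * B'\<^sup>2)"
    and nonzero: "1 - 2 * t - t * z * (B + B') \<noteq> 0"
  shows "B = B'"
proof -
  have "(B - B') * (1 - 2 * t - t * z * (B + B')) =
      (B - t * (1 + 2 * B + z * B\<^sup>2)) - (B' - t * (1 + 2 * B' + z * B'\<^sup>2))"
    by (simp add: power2_eq_square algebra_simps)
  also have "\<dots> = 0" using B B' by simp
  finally show ?thesis using nonzero by simp
qed

lemma fps_const_sum: "fps_const (sum f A) = (\<Sum>x\<in>A. fps_const (f x))"
  by (rule fps_ext) (simp add: fps_sum_nth)

text \<open>This is \<open>u C(z u\<^sup>2)\<close> as a power series in \<open>z\<close>.\<close>
definition catalan_odd_fps :: "rat fps \<Rightarrow> rat fps fps" where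
  "catalan_odd_fps u = Abs_fps (\<lambda>k. fps_const (catalan k) * u ^ Suc (2 * k))"

lemma catalan_odd_fps_eq:
  "catalan_odd_fps u = fps_const u * (1 + fps_X * (catalan_odd_fps u)\<^sup>2)"
proof (rule fps_ext)
  let ?G = "catalan_odd_fps u"
  fix n show "?G $ n = (fps_const u * (1 + fps_X * ?G\<^sup>2)) $ n"
  proof (cases n)
    case (Suc k)
    have "?G $ i * ?G $ (k - i) = fps_const (catalan i * catalan (k - i)) * u ^ (2 * k + 2)"
      if "i \<le> k" for i
    proof -
      have "2 * k + 2 = Suc (2 * i) + Suc (2 * (k - i))" using that by simp
      hence "u ^ (2 * k + 2) = u ^ Suc (2 * i) * u ^ Suc (2 * (k - i))" by (simp only: power_add)
      thus ?thesis
        by (simp only: catalan_odd_fps_def fps_nth_Abs_fps ac_simps flip: fps_const_mult)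
    qed
    hence "(?G\<^sup>2) $ k = fps_const (catalan n) * u ^ (2 * k + 2)"
      by (simp add: power2_eq_square fps_mult_nth atLeast0AtMost Suc catalan_convolution
          fps_const_sum sum_distrib_right del: fps_const_mult)
    thus ?thesis by (simp add: Suc catalan_odd_fps_def ac_simps)
  qed (simp add: catalan_odd_fps_def catalan_0)
qed

lemma fps_swap_A213:
  "fps_swap (A213 - 1) = catalan_odd_fps (fps_X * inverse (1 - 2 * fps_X))"
  (is "?B = ?G")
proof (rule quadratic_root_unique)
  let ?t = "fps_const fps_X :: rat fps fps" and ?u = "fps_X * inverse (1 - 2 * fps_X) :: rat fps"
  show "?B = ?t * (1 + 2 * ?B + fps_X * ?B\<^sup>2)"
    by (subst A213_functional_equation)
      (simp only: mult_2 power2_eq_square fps_swap_add fps_swap_mult fps_swap_1 fps_swap_fps_X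
        fps_swap_const_fps_X)
  have "(1 - 2 * fps_X) * ?u = fps_X"
    by (simp add: mult.left_commute inverse_mult_eq_1')
  moreover have "1 - 2 * ?t = fps_const (1 - 2 * fps_X)"
    by (simp add: numeral_fps_const flip: fps_const_sub)
  ultimately have "(1 - 2 * ?t) * fps_const ?u = ?t" by (simp only: fps_const_mult)
  hence "(1 - 2 * ?t) * ?G = ?t * (1 + fps_X * ?G\<^sup>2)"
    by (subst catalan_odd_fps_eq) (simp flip: mult.assoc)
  thus "?G = ?t * (1 + 2 * ?G + fps_X * ?G\<^sup>2)" by (simp add: algebra_simps)
  have "(1 - 2 * ?t - ?t * fps_X * (?B + ?G)) $ 0 $ 0 \<noteq> 0" by simp
  thus "1 - 2 * ?t - ?t * fps_X * (?B + ?G) \<noteq> 0" by (metis fps_zero_nth)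
qed

section \<open>The coefficients\<close>

lemma inverse_one_minus_const_fps_X_power_nth:
  fixes c :: "'a :: field_char_0"
  shows "inverse ((1 - fps_const c * fps_X) ^ Suc j) $ m = of_nat ((m + j) choose j) * c ^ m"
proof -
  have "inverse ((1 - fps_const c * fps_X) ^ Suc j) $ m = (- c) ^ m * (- of_nat (Suc j) gchoose m)"
    by (simp only: one_minus_fps_X_const_neg_power fps_const_neg fps_nth_compose_linear
        fps_binomial_nth)
  also have "\<dots> = (of_nat (m + j) gchoose m) * c ^ m"
    by (simp only: gbinomial_minus power_minus[of c]) (simp add: add.commute)
  also have "(of_nat (m + j) gchoose m :: 'a) = of_nat ((m + j) choose j)"
    using binomial_symmetric[of m "m + j"]
    by (simp only: binomial_gbinomial[symmetric] le_add1 diff_add_inverse)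
  finally show ?thesis .
qed

lemma a213_Suc: "of_nat (a213 (Suc n) k) = catalan k * (of_nat (n choose (2 * k)) * 2 ^ (n - 2 * k))"
proof -
  have "of_nat (a213 (Suc n) k) = fps_swap (A213 - 1) $ k $ Suc n"
    by (simp add: A213_def)
  also have "\<dots> = catalan k *
      (fps_X ^ Suc (2 * k) * inverse ((1 - fps_const 2 * fps_X) ^ Suc (2 * k))) $ Suc n"
    by (simp only: fps_swap_A213 catalan_odd_fps_def fps_nth_Abs_fps fps_mult_left_const_nth
        power_mult_distrib fps_inverse_power numeral_fps_const)
  also have "\<dots> = catalan k * (of_nat (n choose (2 * k)) * 2 ^ (n - 2 * k))"
    by (simp only: fps_X_power_mult_nth inverse_one_minus_const_fps_X_power_nth)
       (simp add: binomial_eq_0)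
  finally show ?thesis .
qed

lemma a213_eq:
  assumes "n \<ge> 1"
  shows "of_nat (a213 n k) =
    2 powi (int n - 2 * int k - 1) * catalan k * of_nat ((n - 1) choose (2 * k))"
proof (cases "2 * k \<le> n - 1")
  case True
  hence "int n - 2 * int k - 1 = int (n - 1 - 2 * k)" using assms by simp
  hence "(2 :: rat) powi (int n - 2 * int k - 1) = 2 ^ (n - 1 - 2 * k)"
    by (simp only: power_int_of_nat)
  thus ?thesis using a213_Suc[of "n - 1" k] assms by simp
next
  case False
  thus ?thesis using a213_Suc[of "n - 1" k] assms by (simp add: binomial_eq_0)
qed

theorem theorem1:
  shows "embed_z A213 =
           (1 - 2 * var_t + 2 * var_t * var_z
              - fps_sqrt ((1 - 2 * var_t)^2 - 4 * var_t^2 * var_z)) / (2 * var_t * var_z)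
         \<and> (\<forall>n k. n \<ge> 1 \<longrightarrow>
              of_nat (a213 n k) =
                2 powi (int n - 2 * int k - 1) * catalan k * of_nat ((n - 1) choose (2 * k)))"
  using embed_z_A213_closed_form a213_eq by blast

end
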